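(* Let $n\geq 3$ and $2\leq k\leq n$ be integers. Then $$|\mathcal{F}_n(k)|=\binom{n}{k}\sum_{i=0}^{n-k}\binom{n-k}{i}(-1)^{n-k-i}\,i^{\,n-2}.$$
   Context: Let $[n]=\{1,\ldots,n\}$, let $\mathcal{S}_n$ be the symmetric group on $[n]$, and let $\mathcal{C}_n=(1\,2\,\ldots\,n)$. Products of permutations are composed from right to left (the rightmost factor acts first). $\mathcal{F}_n$ is the set of ordered $(n-1)$-tuples $(\sigma_1,\ldots,\sigma_{n-1})$ of transpositions in $\mathcal{S}_n$ with $\sigma_1\cdots\sigma_{n-1}=\mathcal{C}_n$; the $\sigma_i$ are called factors. A transposition on $[n]$ is called a consecutive pair if it can be written as $(s\ t)$ with $t\equiv s+1$ modulo $n$ (so $(n\ 1)$ is a consecutive pair). $\mathcal{F}_n(k)$ is the set of factorizations $(\sigma_1,\ldots,\sigma_{n-1})\in\mathcal{F}_n$ for which exactly $k$ of the indices $i\in\{1,\ldots,n-1\}$ have $\sigma_i$ a consecutive pair. *)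

theory Defs
  imports "HOL-Combinatorics.Combinatorics" "HOL-Number_Theory.Cong"
begin

text \<open>
  Permutations of \<open>{1..n}\<close> are functions \<open>nat \<Rightarrow> nat\<close> fixing everything outside \<open>{1..n}\<close>, as in the
  library; tuples of permutations are lists.
\<close>

definition is_transposition :: "nat \<Rightarrow> (nat \<Rightarrow> nat) \<Rightarrow> bool" where
  "is_transposition n \<tau> \<longleftrightarrow>
     (\<exists>s\<in>{1..n}. \<exists>t\<in>{1..n}. s \<noteq> t \<and> \<tau> = Transposition.transpose s t)"

definition is_consecutive_pair :: "nat \<Rightarrow> (nat \<Rightarrow> nat) \<Rightarrow> bool" where
  "is_consecutive_pair n \<tau> \<longleftrightarrow>
     (\<exists>s\<in>{1..n}. \<exists>t\<in>{1..n}. s \<noteq> t \<and> [t = s + 1] (mod n) \<and> \<tau> = Transposition.transpose s t)"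

definition full_cycle :: "nat \<Rightarrow> nat \<Rightarrow> nat" where
  "full_cycle n = cycle_of_list [1..<n+1]"

definition factorizations :: "nat \<Rightarrow> (nat \<Rightarrow> nat) list set" where
  "factorizations n =
     {\<sigma>. length \<sigma> = n - 1 \<and> (\<forall>\<tau>\<in>set \<sigma>. is_transposition n \<tau>) \<and>
         foldr (\<circ>) \<sigma> id = full_cycle n}"

definition factorizations_with :: "nat \<Rightarrow> nat \<Rightarrow> (nat \<Rightarrow> nat) list set" where
  "factorizations_with n k =
     {\<sigma> \<in> factorizations n. card {i. i < n - 1 \<and> is_consecutive_pair n (\<sigma> ! i)} = k}"

end

theory Submission
  imports Defs
begin

text \<open>
  Write \<open>N n k\<close> for the number of factorizations of the cycle on \<open>n\<close> points with exactly \<open>k\<close>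
  consecutive pairs, and \<open>S j m\<close> for the number of surjections from \<open>m\<close> points onto \<open>j\<close> points, which
  is the alternating sum in the theorem with \<open>j = n - k\<close> and \<open>m = n - 2\<close>. The numbers
  \<open>(n choose k) * S (n - k) (n - 2)\<close> count labelled trees with \<open>n\<close> vertices and \<open>k\<close> leaves, and the
  proof transfers the removal of a leaf from trees to factorizations: consecutive pairs are the
  leaves of the tree dual to the chord diagram of the factors. No trees are needed, though.

  Mark a consecutive pair in a factorization on \<open>m + 1\<close> points. Conjugation by the long cycle rotates
  the points, so it suffices to treat the pair \<open>(m m+1)\<close> and to multiply by \<open>m + 1\<close>
  (\<open>count_consecutive\<close>). Removing this factor and conjugating everything to its right by it gives a
  factorization on \<open>m\<close> points, and every factorization arises in this way once for each of
  the \<open>m\<close> positions (\<open>bij_betw_insert_pair\<close>). That the remaining factors do not move the point \<open>m + 1\<close> is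
  a matter of counting: \<open>m - 1\<close> transpositions on \<open>m + 1\<close> points leave at least four sets invariant, and
  if their product is a cycle on the first \<open>m\<close> points, the singleton of \<open>m + 1\<close> is one of them
  (\<open>transpositions_of_shorter_cycle\<close>).

  Inserting \<open>(m m+1)\<close> creates one consecutive pair and destroys at most one of those present
  (\<open>ncons_insert_pair\<close>, \<open>loss_le_1\<close>). Again by rotation, among the \<open>m * N m k\<close> insertions into factorizations
  with \<open>k\<close> pairs exactly \<open>k * N m k\<close> destroy one (\<open>sum_loss\<close>). This yields the recursion
  \<open>(k + 1) * N (m + 1) (k + 1) = (m + 1) * ((k + 1) * N m (k + 1) + (m - k) * N m k)\<close>
  for \<open>m \<ge> 3\<close>. It leaves \<open>N n 0\<close> open, which vanishes because some point is moved by only one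
  factor on its way to its image (\<open>ncons_pos\<close>). The claimed numbers satisfy the same recursion, by
  \<open>S j (m + 1) = j * (S j m + S (j - 1) m)\<close>.
\<close>

abbreviation swap :: "nat \<Rightarrow> nat \<Rightarrow> nat \<Rightarrow> nat" where
  "swap \<equiv> Transposition.transpose"

abbreviation fprod :: "('a \<Rightarrow> 'a) list \<Rightarrow> 'a \<Rightarrow> 'a" where
  "fprod ts \<equiv> foldr (\<circ>) ts id"

section \<open>Alternating binomial sums\<close>

text \<open>
  By inclusion-exclusion this is the number of surjections from a set of size \<open>m\<close> onto a set of
  size \<open>j\<close>.
\<close>

definition alt_sum :: "nat \<Rightarrow> nat \<Rightarrow> int" where
  "alt_sum j m = (\<Sum>i=0..j. int (j choose i) * (-1) ^ (j - i) * int i ^ m)"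

text \<open>
  In terms of surjections: the last argument has one of \<open>j\<close> values, and the other arguments either
  still cover everything or miss exactly that value.
\<close>

lemma alt_sum_Suc: "alt_sum j (Suc m) = int j * (alt_sum j m + alt_sum (j - 1) m)"
proof (cases j)
  case 0
  then show ?thesis by (simp add: alt_sum_def)
next
  case (Suc j')
  have absorb: "int i * int (j choose i) = int j * (int (j choose i) - int (j' choose i))" for i
  proof (cases i)
    case (Suc i')
    have "i * (j choose i) = j * (j' choose i')"
      using Suc_times_binomial[of i' j'] \<open>j = Suc j'\<close> Suc by simp
    moreover have "j choose i = (j' choose i) + (j' choose i')"
      using \<open>j = Suc j'\<close> Suc by simp
    ultimately show ?thesis
      by (metis add_diff_cancel_left' of_nat_add of_nat_mult)
  qed (use Suc in simp)
  have shift: "(\<Sum>i=0..j. int (j' choose i) * (-1) ^ (j - i) * int i ^ m) = - alt_sum j' m"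
  proof -
    have "(\<Sum>i=0..j. int (j' choose i) * (-1) ^ (j - i) * int i ^ m)
        = (\<Sum>i=0..j'. int (j' choose i) * (-1) ^ (j - i) * int i ^ m)"
      using Suc by simp
    also have "\<dots> = (\<Sum>i=0..j'. - (int (j' choose i) * (-1) ^ (j' - i) * int i ^ m))"
      using Suc by (intro sum.cong) (auto simp: Suc_diff_le)
    finally show ?thesis by (simp add: sum_negf alt_sum_def)
  qed
  have "alt_sum j (Suc m) =
      (\<Sum>i=0..j. (int i * int (j choose i)) * (-1) ^ (j - i) * int i ^ m)"
    by (simp add: alt_sum_def mult_ac)
  also have "\<dots> = int j * (alt_sum j m
      - (\<Sum>i=0..j. int (j' choose i) * (-1) ^ (j - i) * int i ^ m))"
    unfolding absorb by (simp add: alt_sum_def sum_distrib_left sum_subtractf algebra_simps)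
  finally show ?thesis
    using shift Suc by (simp del: sum.atLeast0_atMost_Suc)
qed

lemma alt_sum_eq_0: "m < j \<Longrightarrow> alt_sum j m = 0"
proof (induction m arbitrary: j)
  case 0
  have "alt_sum j 0 = (1 + (-1)) ^ j"
    unfolding binomial_ring alt_sum_def by (simp add: atLeast0AtMost)
  then show ?case using 0 by simp
next
  case (Suc m)
  then show ?case by (simp add: alt_sum_Suc)
qed

section \<open>Products of transpositions and the long cycle\<close>

definition conj_by :: "('a \<Rightarrow> 'a) \<Rightarrow> ('a \<Rightarrow> 'a) \<Rightarrow> 'a \<Rightarrow> 'a" where
  "conj_by f t = f \<circ> t \<circ> inv f"

lemma conj_by_transpose:
  assumes "bij f"
  shows "conj_by f (Transposition.transpose a b) = Transposition.transpose (f a) (f b)"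
proof -
  have "f \<circ> Transposition.transpose a b = Transposition.transpose (f a) (f b) \<circ> f"
    using assms by (simp add: transpose_comp_eq bij_is_inj)
  then show ?thesis
    using assms by (simp add: conj_by_def comp_assoc bij_is_surj surj_iff[symmetric])
      (metis bij_is_surj comp_id surj_iff)
qed

lemma fprod_append: "fprod (xs @ ys) = fprod xs \<circ> fprod ys"
  by (induction xs) (auto simp: comp_assoc)

lemma fprod_conj:
  assumes "bij f"
  shows "fprod (map (conj_by f) ts) = conj_by f (fprod ts)"
  using assms by (induction ts)
    (auto simp: conj_by_def fun_eq_iff bij_is_inj bij_is_surj surj_f_inv_f)

lemma inj_conj_by: "bij f \<Longrightarrow> inj (conj_by f)"
  by (rule injI) (auto simp: conj_by_def fun_eq_iff, metis bij_inv_eq_iff)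

lemma conj_by_swap_twice: "conj_by (swap a b) (conj_by (swap a b) t) = t"
  by (simp add: conj_by_def fun_eq_iff)

lemma is_transposition_conj:
  assumes "f permutes {1..n}" "is_transposition n t"
  shows "is_transposition n (conj_by f t)"
proof -
  obtain a b where ab: "a \<in> {1..n}" "b \<in> {1..n}" "a \<noteq> b" "t = swap a b"
    using assms(2) unfolding is_transposition_def by blast
  have "f a \<in> {1..n}" "f b \<in> {1..n}" "f a \<noteq> f b"
    using ab permutes_in_image[OF assms(1)] permutes_inj[OF assms(1)] by (auto simp: inj_eq)
  then show ?thesis
    unfolding is_transposition_def ab conj_by_transpose[OF permutes_bij[OF assms(1)]] by blast
qed

lemma is_transpositionI:
  "s \<in> {1..n} \<Longrightarrow> t \<in> {1..n} \<Longrightarrow> s \<noteq> t \<Longrightarrow> is_transposition n (swap s t)"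
  unfolding is_transposition_def by blast

lemma is_transposition_permutes: "is_transposition n t \<Longrightarrow> t permutes {1..n}"
  unfolding is_transposition_def by (auto intro: permutes_swap_id)

lemma is_transposition_Suc: "is_transposition n t \<Longrightarrow> is_transposition (Suc n) t"
  unfolding is_transposition_def by (meson atLeastAtMost_iff le_Suc_eq)

lemma is_transposition_fixes_last:
  "is_transposition (Suc n) t \<Longrightarrow> t (Suc n) = Suc n \<longleftrightarrow> is_transposition n t"
proof
  assume "is_transposition (Suc n) t" "t (Suc n) = Suc n"
  then obtain a b where ab: "a \<in> {1..Suc n}" "b \<in> {1..Suc n}" "a \<noteq> b" "t = swap a b"
    unfolding is_transposition_def by blast
  then have "a \<noteq> Suc n" "b \<noteq> Suc n" using \<open>t (Suc n) = Suc n\<close> by auto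
  then show "is_transposition n t" using ab by (auto intro!: is_transpositionI)
next
  assume "is_transposition n t"
  then show "t (Suc n) = Suc n"
    by (intro permutes_not_in[OF is_transposition_permutes]) auto
qed

lemma transposition_eq_swap:
  assumes "is_transposition n t" "t x \<noteq> x"
  shows "t = swap x (t x)"
proof -
  obtain a b where "t = swap a b" using assms(1) unfolding is_transposition_def by blast
  moreover from this assms(2) have "x = a \<or> x = b" by (metis transpose_apply_other)
  ultimately show ?thesis by (metis transpose_apply_first transpose_apply_second transpose_commute)
qed

lemma cycle_of_interval_apply:
  assumes "a \<le> n"
  shows "cycle_of_list [a..<n+1] x = (if x = n then a else if a \<le> x \<and> x < n then x + 1 else x)"
  using assms
proof (induction a arbitrary: x rule: inc_induct)
  case base
  then show ?case by simp
next
  case (step a)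
  have "[a..<n+1] = a # Suc a # [Suc (Suc a)..<n+1]" "[Suc a..<n+1] = Suc a # [Suc (Suc a)..<n+1]"
    using step.hyps by (simp_all add: upt_conv_Cons)
  then have "cycle_of_list [a..<n+1] x = swap a (Suc a) (cycle_of_list [Suc a..<n+1] x)"
    by simp
  then show ?case
    using step.hyps unfolding step.IH by (auto simp: Transposition.transpose_def)
qed

lemma full_cycle_apply:
  "1 \<le> n \<Longrightarrow> full_cycle n x = (if x = n then 1 else if 1 \<le> x \<and> x < n then x + 1 else x)"
  unfolding full_cycle_def by (rule cycle_of_interval_apply)

lemma full_cycle_permutes: "full_cycle n permutes {1..n}"
  using cycle_permutes[of "[1..<n+1]"]
  by (simp del: upt_Suc add: full_cycle_def atLeastLessThanSuc_atLeastAtMost)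

lemma full_cycle_Suc:
  assumes "1 \<le> m"
  shows "full_cycle (Suc m) \<circ> swap m (Suc m) = full_cycle m"
  using assms by (auto simp: fun_eq_iff full_cycle_apply Transposition.transpose_def)

lemma full_cycle_Suc':
  assumes "1 \<le> m"
  shows "full_cycle m \<circ> swap m (Suc m) = full_cycle (Suc m)"
  unfolding full_cycle_Suc[OF assms, symmetric] by (simp add: comp_assoc)

section \<open>Too few transpositions leave a point alone\<close>

definition invariant_sets :: "'a set \<Rightarrow> ('a \<Rightarrow> 'a) list \<Rightarrow> 'a set set" where
  "invariant_sets V ts = {A. A \<subseteq> V \<and> (\<forall>t\<in>set ts. t ` A = A)}"

lemma swap_image_iff:
  "a \<noteq> b \<Longrightarrow> swap a b ` A = A \<longleftrightarrow> (a \<in> A \<longleftrightarrow> b \<in> A)"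
  by (metis in_transpose_image_iff transpose_apply_first transpose_apply_second transpose_image_eq)

text \<open>
  Each transposition at most halves the number of invariant sets: it asks in addition that \<open>a\<close> and
  \<open>b\<close> are both in or both out. If some earlier invariant set \<open>D\<close> violates this, then symmetric
  difference with \<open>D\<close> maps the violating sets injectively to the complying ones.
\<close>

lemma card_invariant_sets:
  assumes "\<forall>t\<in>set ts. is_transposition n t" "finite V"
  shows "2 ^ card V \<le> card (invariant_sets V ts) * 2 ^ length ts"
  using assms(1)
proof (induction ts)
  case Nil
  have "invariant_sets V [] = Pow V" by (auto simp: invariant_sets_def)
  then show ?case using assms(2) by (simp add: card_Pow)
next
  case (Cons t ts)
  obtain a b where t: "t = swap a b" "a \<noteq> b"
    using Cons.prems by (auto simp: is_transposition_def)
  let ?I = "invariant_sets V ts"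
  let ?E = "{A \<in> ?I. a \<in> A \<longleftrightarrow> b \<in> A}"
  let ?D = "{A \<in> ?I. \<not> (a \<in> A \<longleftrightarrow> b \<in> A)}"
  have fin: "finite ?I"
    using assms(2) by (auto simp: invariant_sets_def intro: finite_subset[of _ "Pow V"])
  have sd: "sym_diff A B \<in> ?I" if "A \<in> ?I" "B \<in> ?I" for A B
  proof -
    have "t' ` sym_diff A B = sym_diff A B" if "t' \<in> set ts" for t'
    proof -
      have "inj t'" "t' ` A = A" "t' ` B = B"
        using that \<open>A \<in> ?I\<close> \<open>B \<in> ?I\<close> Cons.prems
        by (auto simp: invariant_sets_def dest!: is_transposition_permutes intro: permutes_inj)
      then show ?thesis by (simp add: image_Un image_set_diff)
    qed
    then show ?thesis using that by (auto simp: invariant_sets_def)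
  qed
  have "card ?D \<le> card ?E"
  proof (cases "?D = {}")
    case True then show ?thesis by (metis card.empty le0)
  next
    case False
    then obtain D where D: "D \<in> ?D" by blast
    have "sym_diff D ` ?D \<subseteq> ?E" using D sd by blast
    moreover have "inj_on (sym_diff D) ?D" by (rule inj_onI) blast
    ultimately show ?thesis using fin by (intro card_inj_on_le) auto
  qed
  moreover have "card ?I = card ?E + card ?D"
    using fin by (subst card_Un_disjoint[symmetric]) (auto intro: arg_cong[where f=card])
  moreover have "invariant_sets V (t # ts) = ?E"
    using t(2) by (auto simp: invariant_sets_def t(1) swap_image_iff)
  ultimately have "card ?I \<le> 2 * card (invariant_sets V (t # ts))" by simp
  then have "card ?I * 2 ^ length ts \<le> (2 * card (invariant_sets V (t # ts))) * 2 ^ length ts"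
    by (rule mult_le_mono1)
  moreover have "2 ^ card V \<le> card ?I * 2 ^ length ts"
    using Cons by simp
  ultimately have "2 ^ card V \<le> (2 * card (invariant_sets V (t # ts))) * 2 ^ length ts"
    by (rule order_trans[rotated])
  then show ?case by (simp only: length_Cons power_Suc mult.commute mult.left_commute)
qed

lemma fprod_image:
  assumes "\<And>t. t \<in> set ts \<Longrightarrow> t ` A = A"
  shows "fprod ts ` A = A"
  using assms
proof (induction ts)
  case Nil
  show ?case by simp
next
  case (Cons t ts)
  have "fprod ts ` A = A" by (rule Cons.IH) (rule Cons.prems, simp)
  moreover have "t ` A = A" by (rule Cons.prems) simp
  moreover have "fprod (t # ts) ` A = t ` (fprod ts ` A)"
    by (simp only: image_comp foldr.simps o_apply)
  ultimately show ?case by (simp only:)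
qed

lemma full_cycle_invariant:
  assumes "full_cycle m ` A = A" "a \<in> A" "a \<in> {1..m}"
  shows "{1..m} \<subseteq> A"
proof -
  have m: "1 \<le> m" using assms(3) by simp
  have next_in: "(if x = m then 1 else x + 1) \<in> A" if "x \<in> A" "x \<in> {1..m}" for x
  proof -
    have "full_cycle m x \<in> A" using assms(1) that(1) by blast
    then show ?thesis using that(2) m by (auto simp: full_cycle_apply split: if_splits)
  qed
  have up: "y \<in> A" if "x \<le> y" "x \<in> A" "1 \<le> x" "y \<le> m" for x y
    using that(1,4)
  proof (induction rule: dec_induct)
    case base
    show ?case by (fact that(2))
  next
    case (step y)
    then show ?case
      using next_in[of y] that(3) by simp
  qed
  have "m \<in> A" using up[of a m] assms by auto
  then have "1 \<in> A" using next_in[of m] m by simp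
  then show ?thesis using up[of 1] by auto
qed

text \<open>
  With only \<open>m - 1\<close> transpositions on \<open>m + 1\<close> points there are at least four invariant sets. They are
  invariant under the product, which is an \<open>m\<close>-cycle and a fixed point, so they are exactly the
  unions of its two orbits. In particular the singleton of the last point is invariant under every
  factor. This replaces the usual argument by connected components of the graph of the factors.
\<close>

lemma transpositions_of_shorter_cycle:
  assumes tr: "\<forall>t\<in>set ts. is_transposition (Suc m) t"
    and len: "length ts = m - 1" and m: "1 \<le> m"
    and prod: "fprod ts = full_cycle m"
  shows "\<forall>t\<in>set ts. is_transposition m t"
proof -
  let ?I = "invariant_sets {1..Suc m} ts"
  let ?F = "{{}, {1..m}, {Suc m}, {1..Suc m}}"
  have "card {1..Suc m} = 2 + length ts" using len m by simp
  then have "2 ^ (2 + length ts) \<le> card ?I * 2 ^ length ts"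
    using card_invariant_sets[OF tr, of "{1..Suc m}"] by (simp only: finite_atLeastAtMost)
  then have "4 * 2 ^ length ts \<le> card ?I * 2 ^ length ts"
    by (simp only: power_add) simp
  then have "4 \<le> card ?I"
    by (simp only: mult_le_cancel2) simp
  have sub: "?I \<subseteq> ?F"
  proof
    fix A assume A: "A \<in> ?I"
    then have "fprod ts ` A = A" by (intro fprod_image) (auto simp: invariant_sets_def)
    then have inv: "full_cycle m ` A = A" by (simp add: prod)
    have AV: "A \<subseteq> insert (Suc m) {1..m}" using A by (auto simp: invariant_sets_def)
    have last: "{1..Suc m} = insert (Suc m) {1..m}" by auto
    show "A \<in> ?F"
    proof (cases "A \<inter> {1..m} = {}")
      case True
      then have "A \<subseteq> {Suc m}" using AV by blast
      then show ?thesis by blast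
    next
      case False
      then have "{1..m} \<subseteq> A" using full_cycle_invariant[OF inv] by blast
      then have "A = {1..m} \<or> A = insert (Suc m) {1..m}" using AV by blast
      then show ?thesis unfolding last by blast
    qed
  qed
  have "card ?F \<le> 4"
    using card_length[of "[{}, {1..m}, {Suc m}, {1..Suc m}]"] by simp
  then have "?I = ?F"
    using sub \<open>4 \<le> card ?I\<close> by (intro card_seteq) simp_all
  then have "{Suc m} \<in> ?I" by simp
  then have "t (Suc m) = Suc m" if "t \<in> set ts" for t
    using that by (auto simp: invariant_sets_def)
  then show ?thesis using tr by (simp add: is_transposition_fixes_last)
qed

section \<open>Consecutive pairs and rotation\<close>

definition pair :: "nat \<Rightarrow> nat \<Rightarrow> nat \<Rightarrow> nat" where
  "pair n s = swap s (full_cycle n s)"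

lemma is_consecutive_pair_iff:
  assumes "2 \<le> n"
  shows "is_consecutive_pair n t \<longleftrightarrow> (\<exists>s\<in>{1..n}. t = pair n s)"
proof -
  have "(s \<noteq> u \<and> [u = s + 1] (mod n)) \<longleftrightarrow> u = full_cycle n s"
    if "s \<in> {1..n}" "u \<in> {1..n}" for s u
  proof (cases "s = n")
    case True
    have "[u = n + 1] (mod n) \<longleftrightarrow> u = 1"
      using that assms by (cases "u = n") (auto simp: cong_def mod_Suc)
    then show ?thesis using True assms by (auto simp: full_cycle_apply)
  next
    case False
    have "[u = s + 1] (mod n) \<longleftrightarrow> u = s + 1"
      using that assms False by (cases "u = n"; cases "s + 1 = n") (auto simp: cong_def mod_Suc)
    then show ?thesis using False that assms by (auto simp: full_cycle_apply)
  qed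
  moreover have "full_cycle n s \<in> {1..n}" if "s \<in> {1..n}" for s
    using that permutes_in_image[OF full_cycle_permutes] by blast
  ultimately show ?thesis
    unfolding is_consecutive_pair_def pair_def by metis
qed

lemma pair_Suc: "1 \<le> s \<Longrightarrow> s < n \<Longrightarrow> pair n s = swap s (Suc s)"
  by (simp add: pair_def full_cycle_apply)

lemma pair_last: "1 \<le> n \<Longrightarrow> pair n n = swap n 1"
  by (simp add: pair_def full_cycle_apply)

lemma full_cycle_neq: "2 \<le> n \<Longrightarrow> s \<in> {1..n} \<Longrightarrow> full_cycle n s \<noteq> s"
  by (auto simp: full_cycle_apply)

lemma pair_inject:
  assumes "3 \<le> n" "s \<in> {1..n}" "u \<in> {1..n}" "pair n s = pair n u"
  shows "s = u"
proof (rule ccontr)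
  assume "s \<noteq> u"
  have "pair n u s = full_cycle n s" "full_cycle n s \<noteq> s"
    using assms full_cycle_neq[of n s] unfolding assms(4)[symmetric] by (simp_all add: pair_def)
  then have "s = full_cycle n u" "u = full_cycle n s"
    using \<open>s \<noteq> u\<close> unfolding pair_def Transposition.transpose_def by presburger+
  then show False using assms(1,2) by (auto simp: full_cycle_apply split: if_splits)
qed

text \<open>
  A sum of indicators instead of the cardinality in the definition of the theorem, because the counts
  below are obtained by exchanging sums.
\<close>

definition ncons :: "nat \<Rightarrow> (nat \<Rightarrow> nat) list \<Rightarrow> nat" where
  "ncons n F = (\<Sum>i<n-1. of_bool (is_consecutive_pair n (F ! i)))"

lemma factorizations_with_iff:
  "F \<in> factorizations_with n k \<longleftrightarrow> F \<in> factorizations n \<and> ncons n F = k"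
proof -
  have "card {i. i < n - 1 \<and> is_consecutive_pair n (F ! i)} = ncons n F"
    unfolding ncons_def by (simp add: Int_def sum_of_bool_eq)
  then show ?thesis by (simp add: factorizations_with_def)
qed

lemma factorizationsD:
  assumes "F \<in> factorizations n"
  shows "length F = n - 1" "\<And>t. t \<in> set F \<Longrightarrow> is_transposition n t" "fprod F = full_cycle n"
  using assms by (auto simp: factorizations_def)

lemma finite_factorizations: "finite (factorizations n)"
proof -
  have "finite {t. is_transposition n t}"
    by (rule finite_subset[of _ "(\<lambda>(s, t). swap s t) ` ({1..n} \<times> {1..n})"])
      (auto simp: is_transposition_def)
  then have "finite {F. set F \<subseteq> {t. is_transposition n t} \<and> length F = n - 1}"
    by (rule finite_lists_length_eq)
  then show ?thesis
    by (rule rev_finite_subset) (auto simp: factorizations_def)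
qed

lemma finite_factorizations_with: "finite (factorizations_with n k)"
  by (rule finite_subset[OF _ finite_factorizations[of n]]) (auto simp: factorizations_with_def)

lemma conj_factorization:
  assumes F: "F \<in> factorizations n"
    and f: "f permutes {1..n}" "conj_by f (full_cycle n) = full_cycle n"
  shows "map (conj_by f) F \<in> factorizations n"
  using factorizationsD[OF F] is_transposition_conj[OF f(1)] f(2)
  by (auto simp: factorizations_def fprod_conj[OF permutes_bij[OF f(1)]])

lemma conj_full_cycle: "conj_by (full_cycle n) (full_cycle n) = full_cycle n"
  using permutes_inv_o(1)[OF full_cycle_permutes] by (simp add: conj_by_def comp_assoc)

lemma conj_inv_full_cycle: "conj_by (inv (full_cycle n)) (full_cycle n) = full_cycle n"
  using permutes_inv_o(2)[OF full_cycle_permutes]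
  by (simp add: conj_by_def inv_inv_eq permutes_bij[OF full_cycle_permutes])

lemma conj_pair: "conj_by (full_cycle n) (pair n s) = pair n (full_cycle n s)"
  unfolding pair_def by (rule conj_by_transpose[OF permutes_bij[OF full_cycle_permutes]])

lemma is_consecutive_pair_conj:
  assumes "2 \<le> n"
  shows "is_consecutive_pair n (conj_by (full_cycle n) t) \<longleftrightarrow> is_consecutive_pair n t"
proof -
  note p = full_cycle_permutes[of n]
  have "(\<exists>s\<in>{1..n}. conj_by (full_cycle n) t = pair n s)
      \<longleftrightarrow> (\<exists>s\<in>full_cycle n ` {1..n}. conj_by (full_cycle n) t = pair n s)"
    unfolding permutes_image[OF p] ..
  also have "\<dots> \<longleftrightarrow> (\<exists>s\<in>{1..n}. conj_by (full_cycle n) t = conj_by (full_cycle n) (pair n s))"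
    unfolding conj_pair by blast
  also have "\<dots> \<longleftrightarrow> (\<exists>s\<in>{1..n}. t = pair n s)"
    using inj_conj_by[OF permutes_bij[OF p]] by (simp add: inj_eq)
  finally show ?thesis unfolding is_consecutive_pair_iff[OF assms] .
qed

definition with_pair_at :: "nat \<Rightarrow> nat \<Rightarrow> nat \<Rightarrow> nat \<Rightarrow> (nat \<Rightarrow> nat) list set" where
  "with_pair_at n k s i = {F \<in> factorizations_with n k. F ! i = pair n s}"

lemma finite_with_pair_at: "finite (with_pair_at n k s i)"
  by (simp add: with_pair_at_def finite_factorizations_with)

lemma card_with_pair_at_le:
  assumes "2 \<le> n" "i < n - 1"
  shows "card (with_pair_at n k s i) \<le> card (with_pair_at n k (full_cycle n s) i)"
proof (rule card_inj_on_le[where f = "map (conj_by (full_cycle n))"])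
  note p = full_cycle_permutes[of n]
  show "inj_on (map (conj_by (full_cycle n))) (with_pair_at n k s i)"
    using inj_conj_by[OF permutes_bij[OF p]] by (metis inj_mapI inj_on_subset subset_UNIV)
  show "map (conj_by (full_cycle n)) ` with_pair_at n k s i \<subseteq> with_pair_at n k (full_cycle n s) i"
  proof
    fix G assume "G \<in> map (conj_by (full_cycle n)) ` with_pair_at n k s i"
    then obtain F where G: "G = map (conj_by (full_cycle n)) F"
      and F: "F \<in> factorizations n" "ncons n F = k" "F ! i = pair n s"
      by (auto simp: with_pair_at_def factorizations_with_iff)
    have len: "length F = n - 1" using factorizationsD[OF F(1)] by blast
    have "ncons n G = ncons n F"
      unfolding ncons_def G using len
      by (intro sum.cong refl) (simp add: is_consecutive_pair_conj[OF assms(1)])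
    moreover have "G \<in> factorizations n"
      unfolding G by (rule conj_factorization[OF F(1) p conj_full_cycle])
    moreover have "G ! i = pair n (full_cycle n s)"
      using F(3) len assms(2) by (simp add: G conj_pair)
    ultimately show "G \<in> with_pair_at n k (full_cycle n s) i"
      using F(2) by (simp add: with_pair_at_def factorizations_with_iff)
  qed
qed (rule finite_with_pair_at)

text \<open>
  Conjugation by the long cycle is a rotation of the points: it keeps the positions of all factors
  and turns the \<open>s\<close>-th consecutive pair into the next one. Going once around the cycle gives a closed
  chain of inequalities.
\<close>

lemma card_with_pair_at_eq:
  assumes "2 \<le> n" "i < n - 1" "s \<in> {1..n}"
  shows "card (with_pair_at n k s i) = card (with_pair_at n k n i)"
proof -
  have up: "card (with_pair_at n k a i) \<le> card (with_pair_at n k b i)" if "a \<le> b" "1 \<le> a" "b \<le> n" for a b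
    using that(1,3)
  proof (induction rule: dec_induct)
    case (step b)
    then show ?case
      using card_with_pair_at_le[OF assms(1,2), of k b] that(2) by (simp add: full_cycle_apply)
  qed simp
  have "card (with_pair_at n k n i) \<le> card (with_pair_at n k 1 i)"
    using card_with_pair_at_le[OF assms(1,2), of k n] assms(1) by (simp add: full_cycle_apply)
  then show ?thesis
    using up[of 1 s] up[of s n] assms(3) by simp
qed

text \<open>
  Double counting of the positions of consecutive pairs; by rotation each of the \<open>n\<close> pairs contributes
  the same.
\<close>

lemma count_consecutive:
  assumes "3 \<le> n"
  shows "k * card (factorizations_with n k) = n * (\<Sum>i<n-1. card (with_pair_at n k n i))"
proof -
  have one: "(of_bool (is_consecutive_pair n t) :: nat) = (\<Sum>s\<in>{1..n}. of_bool (t = pair n s))"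
    for t
  proof (cases "is_consecutive_pair n t")
    case True
    then obtain s where s: "s \<in> {1..n}" "t = pair n s"
      using is_consecutive_pair_iff[of n t] assms by auto
    have "(\<Sum>u\<in>{1..n}. of_bool (t = pair n u)) = (\<Sum>u\<in>{1..n}. of_bool (u = s) :: nat)"
      using s pair_inject[OF assms] by (intro sum.cong) auto
    then show ?thesis using s True by (simp add: of_bool_def)
  next
    case False
    then show ?thesis using is_consecutive_pair_iff[of n t] assms by auto
  qed
  have "k * card (factorizations_with n k) = (\<Sum>F\<in>factorizations_with n k. ncons n F)"
    by (simp add: factorizations_with_iff mult.commute)
  also have "\<dots> = (\<Sum>i<n-1. \<Sum>s\<in>{1..n}. \<Sum>F\<in>factorizations_with n k. of_bool (F ! i = pair n s))"
    unfolding ncons_def one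
    by (subst sum.swap, rule sum.cong[OF refl], rule sum.swap)
  also have "\<dots> = (\<Sum>i<n-1. \<Sum>s\<in>{1..n}. card (with_pair_at n k s i))"
    by (simp add: with_pair_at_def Int_def finite_factorizations_with)
  also have "\<dots> = (\<Sum>i<n-1. \<Sum>s\<in>{1..n}. card (with_pair_at n k n i))"
    using assms by (intro sum.cong refl card_with_pair_at_eq) auto
  finally show ?thesis by (simp add: sum_distrib_left)
qed

section \<open>Inserting and deleting a consecutive pair\<close>

text \<open>
  Pulling the new factor to the right end conjugates the factors that it passes. So the product of
  the new list is the old product times the new factor, which by \<open>full_cycle_Suc'\<close> is the longer
  cycle.
\<close>

definition insert_pair :: "nat \<Rightarrow> nat \<Rightarrow> (nat \<Rightarrow> nat) list \<Rightarrow> (nat \<Rightarrow> nat) list" where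
  "insert_pair m i F = take i F @ swap m (Suc m) # map (conj_by (swap m (Suc m))) (drop i F)"

definition delete_pair :: "nat \<Rightarrow> nat \<Rightarrow> (nat \<Rightarrow> nat) list \<Rightarrow> (nat \<Rightarrow> nat) list" where
  "delete_pair m i G = take i G @ map (conj_by (swap m (Suc m))) (drop (Suc i) G)"

lemma swap_permutes_Suc: "1 \<le> m \<Longrightarrow> swap m (Suc m) permutes {1..Suc m}"
  by (rule permutes_swap_id) auto

lemma map_conj_swap_twice [simp]:
  "map (conj_by (swap a b) \<circ> conj_by (swap a b)) F = F"
  by (rule map_idI) (simp add: conj_by_swap_twice)

lemma insert_pair_in_factorizations:
  assumes "1 \<le> m" "F \<in> factorizations m" "i < m"
  shows "insert_pair m i F \<in> factorizations (Suc m)"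
proof -
  let ?\<tau> = "swap m (Suc m)"
  note F = factorizationsD[OF assms(2)]
  have "length (insert_pair m i F) = m" using F(1) assms by (simp add: insert_pair_def)
  moreover have "is_transposition (Suc m) t" if "t \<in> set (insert_pair m i F)" for t
  proof -
    have *: "is_transposition (Suc m) u" if "u \<in> set F" for u
      using F(2)[OF that] by (rule is_transposition_Suc)
    have "t \<in> set F \<or> t = ?\<tau> \<or> t \<in> conj_by ?\<tau> ` set F"
      using that by (auto simp: insert_pair_def dest: in_set_takeD in_set_dropD)
    then show ?thesis
      using * is_transposition_conj[OF swap_permutes_Suc[OF assms(1)]] assms(1)
      by (auto intro!: is_transpositionI)
  qed
  moreover have "fprod (insert_pair m i F) = full_cycle (Suc m)"
  proof -
    have "fprod (insert_pair m i F)
        = fprod (take i F) \<circ> (?\<tau> \<circ> (?\<tau> \<circ> fprod (drop i F) \<circ> ?\<tau>))"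
      unfolding insert_pair_def fprod_append by (simp add: fprod_conj[simplified] conj_by_def)
    also have "\<dots> = fprod (take i F @ drop i F) \<circ> ?\<tau>"
      unfolding fprod_append by (simp add: fun_eq_iff)
    also have "\<dots> = full_cycle (Suc m)"
      using F(3) full_cycle_Suc'[OF assms(1)] by simp
    finally show ?thesis .
  qed
  ultimately show ?thesis by (simp add: factorizations_def)
qed

lemma nth_insert_pair: "i \<le> length F \<Longrightarrow> insert_pair m i F ! i = swap m (Suc m)"
  by (simp add: insert_pair_def nth_append)

lemma delete_insert_pair: "i \<le> length F \<Longrightarrow> delete_pair m i (insert_pair m i F) = F"
  by (simp add: insert_pair_def delete_pair_def)

lemma insert_delete_pair:
  assumes "i < length G" "G ! i = swap m (Suc m)"
  shows "insert_pair m i (delete_pair m i G) = G"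
  using id_take_nth_drop[OF assms(1)] assms by (simp add: insert_pair_def delete_pair_def min_def)

text \<open>
  Deletion undoes the insertion at the level of products, but a priori leaves transpositions on
  \<open>m + 1\<close> points. There are so few of them that none can move the last point.
\<close>

lemma delete_pair_in_factorizations:
  assumes "1 \<le> m" "G \<in> factorizations (Suc m)" "i < m" "G ! i = swap m (Suc m)"
  shows "delete_pair m i G \<in> factorizations m"
proof -
  let ?\<tau> = "swap m (Suc m)"
  note G = factorizationsD[OF assms(2)]
  let ?D = "delete_pair m i G"
  have len: "length ?D = m - 1" using G(1) assms by (simp add: delete_pair_def)
  have *: "\<forall>t\<in>set ?D. is_transposition (Suc m) t"
    using G(2) is_transposition_conj[OF swap_permutes_Suc[OF assms(1)]]
    by (auto simp: delete_pair_def dest!: in_set_takeD in_set_dropD)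
  have "fprod G = fprod (take i G) \<circ> (?\<tau> \<circ> fprod (drop (Suc i) G))"
  proof -
    have "G = take i G @ ?\<tau> # drop (Suc i) G"
      using id_take_nth_drop[of i G] G(1) assms by simp
    then have "fprod G = fprod (take i G @ ?\<tau> # drop (Suc i) G)" by simp
    then show ?thesis unfolding fprod_append by simp
  qed
  moreover have "fprod ?D = fprod (take i G) \<circ> (?\<tau> \<circ> fprod (drop (Suc i) G) \<circ> ?\<tau>)"
    unfolding delete_pair_def fprod_append by (simp add: fprod_conj[simplified] conj_by_def)
  ultimately have "fprod ?D = full_cycle (Suc m) \<circ> ?\<tau>"
    using G(3) by (simp add: comp_assoc)
  then have prod: "fprod ?D = full_cycle m" by (simp only: full_cycle_Suc[OF assms(1)])
  show ?thesis
    using transpositions_of_shorter_cycle[OF * len assms(1) prod] len prod by (simp add: factorizations_def)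
qed

lemma bij_betw_insert_pair:
  assumes "1 \<le> m" "i < m"
  shows "bij_betw (insert_pair m i) (factorizations m) {G \<in> factorizations (Suc m). G ! i = swap m (Suc m)}"
proof (rule bij_betw_byWitness[where f' = "delete_pair m i"])
  have "i \<le> length F" if "F \<in> factorizations m" for F
    using factorizationsD(1)[OF that] assms by simp
  then show "\<forall>F\<in>factorizations m. delete_pair m i (insert_pair m i F) = F"
    "insert_pair m i ` factorizations m \<subseteq> {G \<in> factorizations (Suc m). G ! i = swap m (Suc m)}"
    using assms by (auto simp: delete_insert_pair nth_insert_pair insert_pair_in_factorizations)
  show "\<forall>G\<in>{G \<in> factorizations (Suc m). G ! i = swap m (Suc m)}. insert_pair m i (delete_pair m i G) = G"
    using assms by (auto intro!: insert_delete_pair dest: factorizationsD(1))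
  show "delete_pair m i ` {G \<in> factorizations (Suc m). G ! i = swap m (Suc m)} \<subseteq> factorizations m"
    using assms by (auto intro: delete_pair_in_factorizations)
qed

lemma card_with_pair_at_Suc:
  assumes "1 \<le> m" "i < m"
  shows "card (with_pair_at (Suc m) k m i) = card {F \<in> factorizations m. ncons (Suc m) (insert_pair m i F) = k}"
proof -
  note b = bij_betw_insert_pair[OF assms]
  have "pair (Suc m) m = swap m (Suc m)" using assms(1) by (rule pair_Suc) simp
  then have "with_pair_at (Suc m) k m i
      = {G \<in> {G \<in> factorizations (Suc m). G ! i = swap m (Suc m)}. ncons (Suc m) G = k}"
    unfolding with_pair_at_def factorizations_with_iff by auto
  also have "\<dots> = insert_pair m i ` {F \<in> factorizations m. ncons (Suc m) (insert_pair m i F) = k}"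
    unfolding bij_betw_imp_surj_on[OF b, symmetric] by blast
  finally show ?thesis
    using bij_betw_imp_inj_on[OF b] by (simp add: card_image inj_on_subset[of _ "factorizations m"])
qed

text \<open>
  The factors in front of the deleted one are not changed by the deletion, hence they do not move
  the last point.
\<close>

lemma factors_before_last_pair:
  assumes "1 \<le> m" "G \<in> factorizations (Suc m)" "i < m" "G ! i = swap m (Suc m)" "j < i"
  shows "(G ! j) (Suc m) = Suc m"
proof -
  have "length G = m" using factorizationsD(1)[OF assms(2)] by simp
  then have "G ! j \<in> set (delete_pair m i G)"
    using assms(3,5) by (auto simp: delete_pair_def in_set_conv_nth intro!: exI[of _ j])
  then have "is_transposition m (G ! j)"
    using delete_pair_in_factorizations[OF assms(1-4)] factorizationsD(2) by blast
  then show ?thesis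
    by (simp add: is_transposition_fixes_last is_transposition_Suc)
qed

section \<open>The effect of an insertion on the number of consecutive pairs\<close>

lemma sum_list_map_take:
  "i \<le> length F \<Longrightarrow> sum_list (map g (take i F)) = (\<Sum>j<i. g (F ! j))"
  by (simp add: sum_list_sum_nth atLeast0LessThan)

lemma sum_list_map_drop:
  fixes g :: "'a \<Rightarrow> nat"
  assumes "i \<le> length F"
  shows "sum_list (map g (drop i F)) = (\<Sum>j=i..<length F. g (F ! j))"
proof -
  have "sum_list (map g (take i F)) + sum_list (map g (drop i F)) = sum_list (map g F)"
    by (metis append_take_drop_id map_append sum_list_append)
  also have "\<dots> = (\<Sum>j<length F. g (F ! j))"
    by (simp add: sum_list_sum_nth atLeast0LessThan)
  also have "\<dots> = (\<Sum>j<i. g (F ! j)) + (\<Sum>j=i..<length F. g (F ! j))"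
    using assms by (simp add: sum.atLeastLessThan_concat atLeast0LessThan[symmetric])
  finally show ?thesis by (simp add: sum_list_map_take[OF assms])
qed

text \<open>
  Two consecutive pairs of \<open>m\<close> points contain \<open>m\<close>. After the insertion at position \<open>i\<close> the last point
  \<open>m\<close> of the circle is split into \<open>m\<close> and \<open>m + 1\<close>; factors before position \<open>i\<close> keep using \<open>m\<close>, later ones
  use \<open>m + 1\<close> instead. Hence a factor stops being consecutive exactly if it is \<open>(m 1)\<close> and stands
  before position \<open>i\<close>, or is \<open>(m-1 m)\<close> and stands at position \<open>i\<close> or later. This value is the pair
  that would be lost if it stood at position \<open>j\<close>.
\<close>

definition absorbed :: "nat \<Rightarrow> nat \<Rightarrow> nat \<Rightarrow> nat \<Rightarrow> nat" where
  "absorbed m i j = pair m (if j < i then m else m - 1)"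

definition loss :: "nat \<Rightarrow> nat \<Rightarrow> (nat \<Rightarrow> nat) list \<Rightarrow> nat" where
  "loss m i F = (\<Sum>j<m-1. of_bool (F ! j = absorbed m i j))"

lemma is_consecutive_pair_Suc:
  assumes "3 \<le> m" "is_transposition m t"
  shows "is_consecutive_pair (Suc m) t \<longleftrightarrow> is_consecutive_pair m t \<and> t \<noteq> pair m m"
proof -
  have fixed: "t (Suc m) = Suc m"
    using assms(2) by (simp add: is_transposition_fixes_last is_transposition_Suc)
  have same: "pair (Suc m) s = pair m s" if "1 \<le> s" "s < m" for s
    using that by (simp add: pair_Suc)
  have "is_consecutive_pair (Suc m) t \<longleftrightarrow> (\<exists>s\<in>{1..Suc m}. t = pair (Suc m) s)"
    using assms(1) by (simp only: is_consecutive_pair_iff)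
  also have "\<dots> \<longleftrightarrow> (\<exists>s\<in>{1..<m}. t = pair m s)"
  proof
    assume "\<exists>s\<in>{1..Suc m}. t = pair (Suc m) s"
    then obtain s where s: "s \<in> {1..Suc m}" "t = pair (Suc m) s" by blast
    have "s \<noteq> m" "s \<noteq> Suc m"
      using s fixed assms(1) by (auto simp: pair_Suc pair_last)
    then have "s \<in> {1..<m}" using s(1) by simp
    then show "\<exists>s\<in>{1..<m}. t = pair m s" using s(2) same[of s] by auto
  next
    assume "\<exists>s\<in>{1..<m}. t = pair m s"
    then obtain s where "s \<in> {1..<m}" "t = pair m s" by blast
    then show "\<exists>s\<in>{1..Suc m}. t = pair (Suc m) s" using same[of s] by (intro bexI[of _ s]) auto
  qed
  also have "\<dots> \<longleftrightarrow> (\<exists>s\<in>{1..m}. t = pair m s) \<and> t \<noteq> pair m m"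
  proof -
    have "{1..m} = insert m {1..<m}" using assms(1) by auto
    moreover have "pair m s \<noteq> pair m m" if "s \<in> {1..<m}" for s
      using pair_inject[OF assms(1), of s m] that by auto
    ultimately show ?thesis by auto
  qed
  also have "\<dots> \<longleftrightarrow> is_consecutive_pair m t \<and> t \<noteq> pair m m"
    using assms(1) by (simp only: is_consecutive_pair_iff)
  finally show ?thesis .
qed

lemma is_consecutive_pair_Suc_conj:
  assumes "3 \<le> m" "is_transposition m t"
  shows "is_consecutive_pair (Suc m) (conj_by (swap m (Suc m)) t)
    \<longleftrightarrow> is_consecutive_pair m t \<and> t \<noteq> pair m (m - 1)"
proof -
  let ?c = "conj_by (swap m (Suc m))"
  have fixed: "t (Suc m) = Suc m"
    using assms(2) by (simp add: is_transposition_fixes_last is_transposition_Suc)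
  have flip: "?c t = u \<longleftrightarrow> t = ?c u" for u
    using conj_by_swap_twice by metis
  have c_swap: "?c (swap a b) = swap (swap m (Suc m) a) (swap m (Suc m) b)" for a b
    by (rule conj_by_transpose) simp
  have same: "?c (pair (Suc m) s) = pair m s" if "1 \<le> s" "s < m - 1" for s
    using that by (simp add: pair_Suc c_swap)
  have last: "?c (pair (Suc m) (Suc m)) = pair m m"
    using assms(1) by (simp add: pair_last c_swap)
  have "is_consecutive_pair (Suc m) (?c t) \<longleftrightarrow> (\<exists>s\<in>{1..Suc m}. t = ?c (pair (Suc m) s))"
    using assms(1) by (simp only: is_consecutive_pair_iff flip)
  also have "\<dots> \<longleftrightarrow> (\<exists>s\<in>insert m {1..<m-1}. t = pair m s)"
  proof
    assume "\<exists>s\<in>{1..Suc m}. t = ?c (pair (Suc m) s)"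
    then obtain s where s: "s \<in> {1..Suc m}" "t = ?c (pair (Suc m) s)" by blast
    have "s \<noteq> m"
      using s fixed assms(1) by (auto simp: pair_Suc c_swap)
    moreover have "s \<noteq> m - 1"
      using s fixed assms(1) by (auto simp: pair_Suc c_swap)
    ultimately have "s = Suc m \<or> s \<in> {1..<m-1}" using s(1) by auto
    then show "\<exists>s\<in>insert m {1..<m-1}. t = pair m s" using s(2) same[of s] last by auto
  next
    assume "\<exists>s\<in>insert m {1..<m-1}. t = pair m s"
    then obtain s where s: "s \<in> insert m {1..<m-1}" "t = pair m s" by blast
    show "\<exists>s\<in>{1..Suc m}. t = ?c (pair (Suc m) s)"
    proof (cases "s = m")
      case True
      then show ?thesis using s last by (intro bexI[of _ "Suc m"]) auto
    next
      case False
      then show ?thesis using s same[of s] by (intro bexI[of _ s]) auto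
    qed
  qed
  also have "\<dots> \<longleftrightarrow> (\<exists>s\<in>{1..m}. t = pair m s) \<and> t \<noteq> pair m (m - 1)"
  proof -
    have "{1..m} = insert (m - 1) (insert m {1..<m-1})" using assms(1) by auto
    moreover have "pair m s \<noteq> pair m (m - 1)" if "s \<in> insert m {1..<m-1}" for s
    proof
      assume "pair m s = pair m (m - 1)"
      then have "s = m - 1"
        using that assms(1) by (intro pair_inject[OF assms(1)]) auto
      then show False using that assms(1) by auto
    qed
    ultimately show ?thesis by auto
  qed
  also have "\<dots> \<longleftrightarrow> is_consecutive_pair m t \<and> t \<noteq> pair m (m - 1)"
    using assms(1) by (simp only: is_consecutive_pair_iff)
  finally show ?thesis .
qed

lemma ncons_insert_pair:
  assumes "3 \<le> m" "F \<in> factorizations m" "i < m"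
  shows "ncons (Suc m) (insert_pair m i F) + loss m i F = Suc (ncons m F)"
proof -
  let ?\<tau> = "swap m (Suc m)"
  let ?P = "\<lambda>t. of_bool (is_consecutive_pair (Suc m) t) :: nat"
  note F = factorizationsD[OF assms(2)]
  have tr: "is_transposition m (F ! j)" if "j < m - 1" for j
    using that F(1,2) by simp
  have len: "length (insert_pair m i F) = m"
    using factorizationsD(1)[OF insert_pair_in_factorizations[OF _ assms(2,3)]] assms(1) by simp
  have tau: "?P ?\<tau> = 1"
    using assms(1) is_consecutive_pair_iff[of "Suc m" ?\<tau>] pair_Suc[of m "Suc m"]
    by (auto intro!: bexI[of _ m])
  have "ncons (Suc m) (insert_pair m i F) = sum_list (map ?P (insert_pair m i F))"
    by (simp add: ncons_def sum_list_sum_nth len atLeast0LessThan)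
  also have "\<dots> = 1 + (sum_list (map ?P (take i F)) + sum_list (map (\<lambda>t. ?P (conj_by ?\<tau> t)) (drop i F)))"
    using tau by (simp add: insert_pair_def comp_def)
  also have "\<dots> = 1 + ((\<Sum>j<i. ?P (F ! j)) + (\<Sum>j=i..<m-1. ?P (conj_by ?\<tau> (F ! j))))"
    using assms(3) F(1) by (simp add: sum_list_map_take sum_list_map_drop)
  also have "\<dots> = 1 + (\<Sum>j<m-1. of_bool (is_consecutive_pair m (F ! j) \<and> F ! j \<noteq> absorbed m i j))"
  proof -
    have "(\<Sum>j<i. ?P (F ! j))
        = (\<Sum>j=0..<i. of_bool (is_consecutive_pair m (F ! j) \<and> F ! j \<noteq> absorbed m i j))"
      unfolding atLeast0LessThan
      using assms(1,3) by (intro sum.cong refl) (simp add: absorbed_def is_consecutive_pair_Suc tr)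
    moreover have "(\<Sum>j=i..<m-1. ?P (conj_by ?\<tau> (F ! j)))
        = (\<Sum>j=i..<m-1. of_bool (is_consecutive_pair m (F ! j) \<and> F ! j \<noteq> absorbed m i j))"
      using assms(1) by (intro sum.cong refl) (simp add: absorbed_def is_consecutive_pair_Suc_conj tr)
    ultimately show ?thesis
      using assms(3)
      by (simp add: sum.atLeastLessThan_concat del: sum_of_bool_eq flip: atLeast0LessThan)
  qed
  finally have "ncons (Suc m) (insert_pair m i F) + loss m i F
      = 1 + (\<Sum>j<m-1. of_bool (is_consecutive_pair m (F ! j) \<and> F ! j \<noteq> absorbed m i j)
                 + of_bool (F ! j = absorbed m i j))"
    by (simp add: loss_def sum.distrib)
  also have "(\<Sum>j<m-1. of_bool (is_consecutive_pair m (F ! j) \<and> F ! j \<noteq> absorbed m i j)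
                 + of_bool (F ! j = absorbed m i j)) = ncons m F"
  proof -
    have "is_consecutive_pair m (absorbed m i j)" for j
    proof -
      have "(if j < i then m else m - 1) \<in> {1..m}"
        using assms(1) by (cases "j < i") simp_all
      then show ?thesis
        unfolding absorbed_def using is_consecutive_pair_iff[of m] assms(1) by auto
    qed
    then show ?thesis
      unfolding ncons_def by (intro sum.cong refl) (auto simp: of_bool_def)
  qed
  finally show ?thesis by simp
qed

lemma factors_before_pair:
  assumes "3 \<le> m" "F \<in> factorizations m" "j < m - 1" "F ! j = pair m (m - 1)" "j' < j"
  shows "(F ! j') m = m"
proof -
  obtain m' where m': "m = Suc m'" using assms(1) by (cases m) auto
  then show ?thesis
    using factors_before_last_pair[of m' F j j'] assms by (simp add: pair_Suc)
qed

lemma pair_moves_last: "3 \<le> m \<Longrightarrow> pair m m m \<noteq> m" "3 \<le> m \<Longrightarrow> pair m (m - 1) m \<noteq> m"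
  by (auto simp: pair_last pair_Suc)

text \<open>
  Rotating backwards turns \<open>(m 1)\<close> into \<open>(m-1 m)\<close>, in front of which no factor moves \<open>m\<close>.
\<close>

lemma last_pair_once:
  assumes "3 \<le> m" "F \<in> factorizations m" "j < m - 1" "F ! j = pair m m" "j' < j"
  shows "F ! j' \<noteq> pair m m"
proof
  assume *: "F ! j' = pair m m"
  let ?f = "inv (full_cycle m)"
  note p = full_cycle_permutes[of m]
  have inv: "?f permutes {1..m}" by (rule permutes_inv[OF p])
  have "conj_by ?f (pair m m) = swap (?f m) (?f (full_cycle m m))"
    unfolding pair_def by (rule conj_by_transpose[OF permutes_bij[OF inv]])
  also have "?f (full_cycle m m) = m" by (simp add: permutes_inverses[OF p])
  also have "?f m = m - 1"
    using assms(1) by (intro permutes_inv_eq[OF p, THEN iffD2]) (auto simp: full_cycle_apply)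
  also have "swap (m - 1) m = pair m (m - 1)" using assms(1) by (simp add: pair_Suc)
  finally have c: "conj_by ?f (pair m m) = pair m (m - 1)" .
  let ?F = "map (conj_by ?f) F"
  have len: "length F = m - 1" using factorizationsD(1)[OF assms(2)] .
  have "(?F ! j') m = m"
  proof (rule factors_before_pair[OF assms(1) _ assms(3) _ assms(5)])
    show "?F \<in> factorizations m"
      by (rule conj_factorization[OF assms(2) inv conj_inv_full_cycle])
    show "?F ! j = pair m (m - 1)" using len assms(3,4) c by simp
  qed
  moreover have "?F ! j' = pair m (m - 1)" using len assms(3,5) * c by simp
  ultimately show False using pair_moves_last(2)[OF assms(1)] by simp
qed

text \<open>
  Of two lost factors, the later one would be a pair at \<open>m\<close> that stands behind a factor moving \<open>m\<close>.
  If the later one is \<open>(m-1 m)\<close>, this contradicts \<open>factors_before_pair\<close>; otherwise both lie before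
  position \<open>i\<close> and are equal to \<open>(m 1)\<close>, which contradicts \<open>last_pair_once\<close>.
\<close>

lemma loss_le_1:
  assumes "3 \<le> m" "F \<in> factorizations m"
  shows "loss m i F \<le> 1"
proof -
  let ?J = "{j. j < m - 1 \<and> F ! j = absorbed m i j}"
  have no: False if "j' \<in> ?J" "j \<in> ?J" "j' < j" for j j'
  proof (cases "j < i")
    case True
    then show False
      using last_pair_once[OF assms, of j j'] that by (auto simp: absorbed_def)
  next
    case False
    then have "(F ! j') m = m"
      using factors_before_pair[OF assms, of j j'] that by (auto simp: absorbed_def)
    moreover have "F ! j' = absorbed m i j'" using that by simp
    ultimately show False
      using pair_moves_last[OF assms(1)] by (auto simp: absorbed_def split: if_splits)
  qed
  have "finite ?J" by simp
  moreover have "\<forall>a\<in>?J. \<forall>b\<in>?J. a = b"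
  proof (intro ballI)
    fix a b assume ab: "a \<in> ?J" "b \<in> ?J"
    show "a = b"
      using no[OF ab] no[OF ab(2,1)] by (cases a b rule: linorder_cases) simp_all
  qed
  ultimately have "card ?J \<le> Suc 0" by (subst card_le_Suc0_iff_eq)
  moreover have "loss m i F = card ?J" by (simp add: loss_def Int_def sum_of_bool_eq)
  ultimately show ?thesis by simp
qed

text \<open>
  For fixed \<open>j\<close> the lost pair is one of two consecutive pairs, depending on \<open>i\<close>, and by rotation both
  occur at position \<open>j\<close> equally often. So the sum over the \<open>m\<close> insertion positions \<open>i\<close> is \<open>m\<close> times the
  number of occurrences of a single pair, to which \<open>count_consecutive\<close> applies.
\<close>

lemma sum_loss:
  assumes "3 \<le> m"
  shows "(\<Sum>i<m. \<Sum>F\<in>factorizations_with m k. loss m i F) = k * card (factorizations_with m k)"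
proof -
  have "(\<Sum>F\<in>factorizations_with m k. loss m i F) = (\<Sum>j<m-1. card (with_pair_at m k m j))" for i
  proof -
    have "(\<Sum>F\<in>factorizations_with m k. loss m i F)
        = (\<Sum>j<m-1. card {F \<in> factorizations_with m k. F ! j = absorbed m i j})"
      unfolding loss_def by (subst sum.swap) (simp add: Int_def finite_factorizations_with)
    also have "\<dots> = (\<Sum>j<m-1. card (with_pair_at m k m j))"
    proof (rule sum.cong[OF refl])
      fix j assume "j \<in> {..<m-1}"
      then show "card {F \<in> factorizations_with m k. F ! j = absorbed m i j} = card (with_pair_at m k m j)"
        using card_with_pair_at_eq[of m j "m - 1" k] assms by (auto simp: absorbed_def with_pair_at_def)
    qed
    finally show ?thesis .
  qed
  then show ?thesis using count_consecutive[OF assms, of k] by simp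
qed

text \<open>
  The left-hand side counts factorizations with a marked consecutive pair. By rotation the marked
  pair may be taken to be \<open>(m m+1)\<close>. Deleting it leaves either \<open>k\<close> consecutive pairs, or \<open>k + 1\<close> of
  which the insertion destroyed one; \<open>sum_loss\<close> says how often each happens.
\<close>

lemma card_factorizations_with_Suc:
  assumes "3 \<le> m"
  shows "int (Suc k) * int (card (factorizations_with (Suc m) (Suc k))) =
    int (Suc m) * (int (Suc k) * int (card (factorizations_with m (Suc k)))
      + (int m - int k) * int (card (factorizations_with m k)))"
proof -
  let ?N = "\<lambda>k. factorizations_with m k"
  let ?z = "\<lambda>i. card {F \<in> ?N k. loss m i F = 0}"
  have one: "card {F \<in> ?N k. loss m i F = 1} = (\<Sum>F\<in>?N k. loss m i F)" for i k
  proof -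
    have "loss m i F = of_bool (loss m i F = 1)" if "F \<in> ?N k" for F
      using loss_le_1[OF assms, of F i] that by (auto simp: factorizations_with_iff of_bool_def)
    then have "(\<Sum>F\<in>?N k. loss m i F) = (\<Sum>F\<in>?N k. of_bool (loss m i F = 1))"
      by (rule sum.cong[OF refl])
    then show ?thesis by (simp add: Int_def finite_factorizations_with)
  qed
  have split: "card (with_pair_at (Suc m) (Suc k) m i) = ?z i + (\<Sum>F\<in>?N (Suc k). loss m i F)"
    if "i < m" for i
  proof -
    have "{F \<in> factorizations m. ncons (Suc m) (insert_pair m i F) = Suc k}
        = {F \<in> ?N k. loss m i F = 0} \<union> {F \<in> ?N (Suc k). loss m i F = 1}"
    proof (intro set_eqI)
      fix F
      have "ncons (Suc m) (insert_pair m i F) = Suc k \<longleftrightarrow>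
          (ncons m F = k \<and> loss m i F = 0) \<or> (ncons m F = Suc k \<and> loss m i F = 1)"
        if F: "F \<in> factorizations m"
        using ncons_insert_pair[OF assms F \<open>i < m\<close>] loss_le_1[OF assms F, of i] by auto
      then show "F \<in> {F \<in> factorizations m. ncons (Suc m) (insert_pair m i F) = Suc k} \<longleftrightarrow>
          F \<in> {F \<in> ?N k. loss m i F = 0} \<union> {F \<in> ?N (Suc k). loss m i F = 1}"
        by (auto simp: factorizations_with_iff)
    qed
    then have "card (with_pair_at (Suc m) (Suc k) m i) = ?z i + card {F \<in> ?N (Suc k). loss m i F = 1}"
      using card_with_pair_at_Suc[of m i "Suc k"] assms that
      by (simp add: card_Un_disjoint finite_factorizations_with disjoint_iff)
    then show ?thesis by (simp only: one)
  qed
  have "?z i + (\<Sum>F\<in>?N k. loss m i F) = card (?N k)" for i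
  proof -
    have "?N k = {F \<in> ?N k. loss m i F = 0} \<union> {F \<in> ?N k. loss m i F = 1}"
      using loss_le_1[OF assms, of _ i] by (force simp: factorizations_with_iff le_Suc_eq)
    then have "card (?N k) = card ({F \<in> ?N k. loss m i F = 0} \<union> {F \<in> ?N k. loss m i F = 1})"
      by (rule arg_cong)
    also have "\<dots> = ?z i + card {F \<in> ?N k. loss m i F = 1}"
      by (rule card_Un_disjoint) (auto simp: finite_factorizations_with)
    finally show ?thesis by (simp only: one)
  qed
  then have "(\<Sum>i<m. ?z i + (\<Sum>F\<in>?N k. loss m i F)) = m * card (?N k)" by simp
  then have zeros: "(\<Sum>i<m. ?z i) + k * card (?N k) = m * card (?N k)"
    by (simp add: sum.distrib sum_loss[OF assms])
  have "Suc k * card (factorizations_with (Suc m) (Suc k))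
      = Suc m * (\<Sum>i<m. card (with_pair_at (Suc m) (Suc k) (Suc m) i))"
    using count_consecutive[of "Suc m" "Suc k"] assms by simp
  also have "(\<Sum>i<m. card (with_pair_at (Suc m) (Suc k) (Suc m) i)) = (\<Sum>i<m. card (with_pair_at (Suc m) (Suc k) m i))"
    using assms by (intro sum.cong refl card_with_pair_at_eq[symmetric]) auto
  also have "\<dots> = (\<Sum>i<m. ?z i) + Suc k * card (?N (Suc k))"
    by (simp add: split sum.distrib sum_loss[OF assms, symmetric] del: mult_Suc)
  finally have rec: "Suc k * card (factorizations_with (Suc m) (Suc k))
      = Suc m * ((\<Sum>i<m. ?z i) + Suc k * card (?N (Suc k)))" .
  have "int (Suc k) * int (card (factorizations_with (Suc m) (Suc k)))
      = int (Suc m) * (int (\<Sum>i<m. ?z i) + int (Suc k) * int (card (?N (Suc k))))"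
    using arg_cong[OF rec, of int] by (simp only: of_nat_add of_nat_mult)
  moreover have "int (\<Sum>i<m. ?z i) = (int m - int k) * int (card (?N k))"
  proof -
    have "int (\<Sum>i<m. ?z i) + int k * int (card (?N k)) = int m * int (card (?N k))"
      using arg_cong[OF zeros, of int] by (simp only: of_nat_add of_nat_mult)
    then show ?thesis by (simp only: left_diff_distrib)
  qed
  ultimately show ?thesis by (simp only: add.commute)
qed

section \<open>Every factorization contains a consecutive pair\<close>

text \<open>
  The number of factors that displace the token starting at \<open>x\<close>, when the factors act one after the
  other from the right.
\<close>

primrec moves :: "('a \<Rightarrow> 'a) list \<Rightarrow> 'a \<Rightarrow> nat" where
  "moves [] x = 0"
| "moves (t # ts) x = moves ts x + of_bool (t (fprod ts x) \<noteq> fprod ts x)"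

lemma moves_eq_0: "moves ts x = 0 \<Longrightarrow> fprod ts x = x"
  by (induction ts) auto

lemma moves_eq_1: "moves ts x = 1 \<Longrightarrow> \<exists>t\<in>set ts. t x = fprod ts x \<and> t x \<noteq> x"
proof (induction ts)
  case (Cons t ts)
  show ?case
  proof (cases "t (fprod ts x) = fprod ts x")
    case True
    then have "moves ts x = 1" and eq: "fprod (t # ts) x = fprod ts x"
      using Cons.prems by simp_all
    then obtain u where "u \<in> set ts" "u x = fprod ts x" "u x \<noteq> x"
      using Cons.IH by blast
    then show ?thesis unfolding eq by (intro bexI[of _ u]) simp_all
  next
    case False
    then have "moves ts x = 0" using Cons.prems by simp
    then have fixed: "fprod ts x = x" by (rule moves_eq_0)
    then have eq: "fprod (t # ts) x = t x" by simp
    show ?thesis unfolding eq using False fixed by (intro bexI[of _ t]) simp_all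
  qed
qed simp

lemma fprod_permutes: "(\<And>t. t \<in> set ts \<Longrightarrow> t permutes A) \<Longrightarrow> fprod ts permutes A"
  by (induction ts) (simp_all add: permutes_id permutes_compose)

lemma sum_moves:
  assumes "\<And>t. t \<in> set ts \<Longrightarrow> is_transposition n t"
  shows "(\<Sum>x\<in>{1..n}. moves ts x) = 2 * length ts"
  using assms
proof (induction ts)
  case (Cons t ts)
  obtain a b where t: "t = swap a b" "a \<noteq> b" "a \<in> {1..n}" "b \<in> {1..n}"
    using Cons.prems[of t] by (auto simp: is_transposition_def)
  have p: "fprod ts permutes {1..n}"
    by (rule fprod_permutes) (use Cons.prems is_transposition_permutes in auto)
  have "(\<Sum>x\<in>{1..n}. of_bool (t (fprod ts x) \<noteq> fprod ts x)) = (\<Sum>x\<in>{1..n}. of_bool (t x \<noteq> x) :: nat)"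
    using sum.permute[OF p, of "\<lambda>x. of_bool (t x \<noteq> x) :: nat"]
    by (simp only: o_def)
  also have "\<dots> = card {x \<in> {1..n}. t x \<noteq> x}" by (simp add: Int_def)
  also have "{x \<in> {1..n}. t x \<noteq> x} = {a, b}"
    using t by (auto simp: Transposition.transpose_def)
  also have "card {a, b} = 2" using t(2) by simp
  finally have "(\<Sum>x\<in>{1..n}. moves (t # ts) x) = (\<Sum>x\<in>{1..n}. moves ts x) + 2"
    by (simp only: moves.simps sum.distrib)
  then show ?case using Cons by simp
qed simp

text \<open>
  Each factor displaces two tokens, so the \<open>n - 1\<close> factors make \<open>2 * n - 2\<close> displacements in total. As no
  token returns to its start, some token \<open>x\<close> is displaced exactly once, and the factor which does
  this exchanges \<open>x\<close> with its image under the cycle.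
\<close>

lemma ncons_pos:
  assumes "2 \<le> n" "F \<in> factorizations n"
  shows "0 < ncons n F"
proof -
  note F = factorizationsD[OF assms(2)]
  have "\<exists>x\<in>{1..n}. moves F x < 2"
  proof (rule ccontr)
    assume "\<not> (\<exists>x\<in>{1..n}. moves F x < 2)"
    then have "(\<Sum>x\<in>{1..n}. 2) \<le> (\<Sum>x\<in>{1..n}. moves F x)"
      by (intro sum_mono) force
    then show False using sum_moves[OF F(2)] F(1) assms(1) by simp
  qed
  then obtain x where x: "x \<in> {1..n}" "moves F x < 2" by blast
  have "moves F x \<noteq> 0"
    using moves_eq_0[of F x] full_cycle_neq[OF assms(1) x(1)] F(3) by metis
  then have "moves F x = 1" using x(2) by simp
  then obtain t where t: "t \<in> set F" "t x = full_cycle n x" "t x \<noteq> x"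
    using moves_eq_1[of F x] F(3) by metis
  have "t = pair n x"
    using transposition_eq_swap[OF F(2)[OF t(1)] t(3)] t(2) by (simp add: pair_def)
  then have "is_consecutive_pair n t"
    using is_consecutive_pair_iff[OF assms(1)] x(1) by blast
  moreover obtain i where "i < n - 1" "F ! i = t"
    using t(1) F(1) by (auto simp: in_set_conv_nth)
  ultimately show ?thesis
    unfolding ncons_def by (intro sum_pos2[of _ i]) auto
qed

section \<open>The count\<close>

lemma factorizations_2: "factorizations 2 = {[swap 1 2]}"
proof -
  have C: "full_cycle 2 = swap 1 2"
    by (auto simp: fun_eq_iff full_cycle_apply Transposition.transpose_def)
  have "is_transposition 2 (swap 1 2)" by (rule is_transpositionI) auto
  then show ?thesis
    by (auto simp: factorizations_def C length_Suc_conv)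
qed

lemma is_consecutive_pair_3:
  assumes "is_transposition 3 t"
  shows "is_consecutive_pair 3 t"
proof -
  obtain a b where ab: "a \<in> {1..3}" "b \<in> {1..3}" "a \<noteq> b" "t = swap a b"
    using assms unfolding is_transposition_def by blast
  then have "(a = 1 \<or> a = 2 \<or> a = 3)" "(b = 1 \<or> b = 2 \<or> b = 3)" by auto
  moreover have "pair 3 1 = swap 1 2" "pair 3 2 = swap 2 3" "pair 3 3 = swap 3 1"
    by (simp_all add: pair_def full_cycle_apply numeral_2_eq_2 numeral_3_eq_3)
  ultimately have "t = pair 3 1 \<or> t = pair 3 2 \<or> t = pair 3 3"
    using ab(3,4) by (elim disjE) (simp_all add: transpose_commute)
  then show ?thesis
    by (subst is_consecutive_pair_iff) auto
qed

lemma ncons_3: "F \<in> factorizations 3 \<Longrightarrow> ncons 3 F = 2"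
  using factorizationsD[of F 3] by (simp add: ncons_def is_consecutive_pair_3)

text \<open>
  For \<open>n = 3\<close> all transpositions are consecutive pairs, so \<open>count_consecutive\<close> with \<open>k = 2\<close> counts
  all factorizations.
\<close>

lemma card_factorizations_with_3:
  "card (factorizations_with 3 k) = (if k = 2 then 3 else 0)"
proof (cases "k = 2")
  case True
  have "card (with_pair_at 3 2 3 i) = 1" if "i < 2" for i
  proof -
    have "card (with_pair_at 3 2 3 i) = card (with_pair_at 3 2 2 i)"
      using card_with_pair_at_eq[of 3 i 2 2] that by simp
    also have "\<dots> = card {F \<in> factorizations 2. ncons 3 (insert_pair 2 i F) = 2}"
      using card_with_pair_at_Suc[of 2 i 2] that by (simp add: numeral_3_eq_3)
    also have "{F \<in> factorizations 2. ncons 3 (insert_pair 2 i F) = 2} = factorizations 2"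
    proof -
      have "insert_pair 2 i F \<in> factorizations 3" if "F \<in> factorizations 2" for F
        using insert_pair_in_factorizations[of 2 F i] that \<open>i < 2\<close> by (simp add: numeral_3_eq_3)
      then show ?thesis using ncons_3 by blast
    qed
    finally show ?thesis by (simp add: factorizations_2)
  qed
  then have "2 * card (factorizations_with 3 2) = 6"
    using count_consecutive[of 3 2] by simp
  then show ?thesis using True by simp
next
  case False
  then have "factorizations_with 3 k = {}" by (auto simp: factorizations_with_iff ncons_3)
  then show ?thesis using False by simp
qed

text \<open>
  The recursion \<open>card_factorizations_with_Suc\<close> determines the numbers for positive \<open>k\<close>, and the
  right-hand side satisfies the same recursion. The case \<open>k = 0\<close>, on which the recursion depends, is
  supplied by \<open>ncons_pos\<close>; on the right-hand side there is no surjection onto a larger set.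
\<close>

lemma card_factorizations_with:
  assumes "3 \<le> n"
  shows "int (card (factorizations_with n k)) = int (n choose k) * alt_sum (n - k) (n - 2)"
  using assms
proof (induction n arbitrary: k rule: dec_induct)
  case base
  have "k = 0 \<or> k = 1 \<or> k = 2 \<or> k = 3 \<or> 3 < k" by linarith
  then show ?case
    unfolding card_factorizations_with_3
    by (elim disjE) (simp_all add: alt_sum_eq_0 alt_sum_def
      numeral_3_eq_3 numeral_2_eq_2)
next
  case (step m)
  show ?case
  proof (cases k)
    case 0
    have "factorizations_with (Suc m) 0 = {}"
      using ncons_pos[of "Suc m"] step.hyps by (force simp: factorizations_with_iff)
    then show ?thesis using 0 by (simp add: alt_sum_eq_0)
  next
    case (Suc k')
    let ?S = "alt_sum (m - k') (m - 2)" and ?T = "alt_sum (m - k' - 1) (m - 2)"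
    have absorb: "int (Suc k') * int (m choose Suc k') = (int m - int k') * int (m choose k')"
    proof (cases "k' \<le> m")
      case True
      have "Suc k' * (m choose Suc k') = (m - k') * (m choose k')"
        using binomial_absorb_comp[of m k'] binomial_absorption[of k' m] by simp
      then have "int (Suc k') * int (m choose Suc k') = int (m - k') * int (m choose k')"
        by (simp only: flip: of_nat_mult)
      then show ?thesis using True by (simp only: of_nat_diff)
    qed (simp add: binomial_eq_0)
    have "int (Suc k') * int (card (factorizations_with (Suc m) (Suc k')))
        = int (Suc m) * ((int (Suc k') * int (m choose Suc k')) * ?T
            + (int m - int k') * (int (m choose k') * ?S))"
      unfolding card_factorizations_with_Suc[OF step.hyps(1)] step.IH by (simp add: mult.assoc)
    also have "\<dots> = (int (Suc m) * int (m choose k')) * ((int m - int k') * (?S + ?T))"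
      unfolding absorb by (simp add: algebra_simps)
    also have "int (Suc m) * int (m choose k') = int (Suc k') * int (Suc m choose Suc k')"
      by (metis Suc_times_binomial_eq mult.commute of_nat_mult)
    finally have "int (card (factorizations_with (Suc m) (Suc k')))
        = int (Suc m choose Suc k') * ((int m - int k') * (?S + ?T))"
      by (simp only: mult.assoc mult_cancel_left) simp
    also have "\<dots> = int (Suc m choose Suc k') * alt_sum (m - k') (m - 1)"
    proof (cases "k' \<le> m")
      case True
      have "m - 1 = Suc (m - 2)" using step.hyps by simp
      then show ?thesis using True by (simp add: alt_sum_Suc of_nat_diff)
    qed (simp add: binomial_eq_0)
    finally show ?thesis
      using Suc by simp
  qed
qed

theorem mainTheorem2:
  fixes n k :: nat
  assumes "n \<ge> 3" and "2 \<le> k" and "k \<le> n"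
  shows "int (card (factorizations_with n k)) =
    int (n choose k) *
      (\<Sum>i=0..n-k. int ((n - k) choose i) * (-1) ^ (n - k - i) * int i ^ (n - 2))"
  using card_factorizations_with[OF assms(1), of k] unfolding alt_sum_def .

end
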